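(* Let $(F,\mu,\eta)$ be a $q$-unital monad on a category $\mathbb{A}$. (1) The following are equivalent: (a) $(F,\mu,\eta)$ is an $r$-unital monad; (b) $(\phi_F,U_F,\alpha_F,\beta_F)$ is a regular pairing of functors between $\mathbb{A}$ and $\underline{\mathbb{A}}_F$. (2) The following are equivalent: (a) $(F,\mu,\eta)$ is a weak monad; (b) $(\phi_F,U_F,\alpha_F,\beta_F)$ is a regular pairing between $\mathbb{A}$ and $\underline{\mathbb{A}}_F$ with $\alpha_F$ symmetric.
   Context: A pairing $(L,R,\alpha,\beta)$ of functors $L:\mathbb{A}\to\mathbb{B}$, $R:\mathbb{B}\to\mathbb{A}$ consists of maps $\alpha:\mathrm{Mor}_{\mathbb{B}}(L(A),B)\to\mathrm{Mor}_{\mathbb{A}}(A,R(B))$ and $\beta:\mathrm{Mor}_{\mathbb{A}}(A,R(B))\to\mathrm{Mor}_{\mathbb{B}}(L(A),B)$, natural in $A\in\mathbb{A}$, $B\in\mathbb{B}$. Its quasi-unit is $\eta_A=\alpha(I_{L(A)})$ and its quasi-counit is $\varepsilon_B=\beta(I_{R(B)})$. The pairing is regular if $\alpha=\alpha\cdot\beta\cdot\alpha$ and $\beta=\beta\cdot\alpha\cdot\beta$. $\alpha$ is symmetric if $R\varepsilon L\cdot RL\eta=R\varepsilon L\cdot\eta RL:RL\to RL$. A $q$-unital monad $(F,\mu,\eta)$ on $\mathbb{A}$ is an endofunctor $F$ with natural transformations $\mu:FF\to F$, $\mu\cdot F\mu=\mu\cdot\mu F$, and $\eta:I_{\mathbb{A}}\to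 F$ (no further condition). $\eta$ is regular if $\mu\cdot F\eta\cdot\eta=\eta$, and symmetric if $\mu\cdot F\eta=\mu\cdot\eta F$; $\mu$ is compatible if $\mu=\mu\cdot\mu F\cdot F\eta F$. The $q$-unital monad is $r$-unital if $\eta$ is regular and $\mu$ is compatible; it is a weak monad if it is $r$-unital and $\eta$ is symmetric. A non-unital $F$-module is $(A,\varrho:F(A)\to A)$ with $\varrho\cdot F\varrho=\varrho\cdot\mu_A$; it is compatible if $\varrho=\varrho\cdot\mu_A\cdot F\eta_A$. Morphisms are $f$ with $\varrho'\cdot F(f)=f\cdot\varrho$; their set is $\mathrm{Mor}_F(A,A')$. $\underline{\mathbb{A}}_F$ is the category of compatible $F$-modules. $\phi_F(A)=(F(A),\mu_A)$ is the free functor, $U_F$ the forgetful functor, and for $A\in\mathbb{A}$ and an $F$-module $(B,\varrho)$, $$\alpha_F:\mathrm{Mor}_F(\phi_F(A),B)\to\mathrm{Mor}_{\mathbb{A}}(A,U_F(B)),\ f\mapsto f\cdot\eta_A,$$ $$\beta_F:\mathrm{Mor}_{\mathbb{A}}(A,U_F(B))\to\mathrm{Mor}_F(\phi_F(A),B),\ g\mapsto\varrho\cdot F(g).$$ Asserting that this is a pairing between $\mathbb{A}$ and $\underline{\mathbb{A}}_F$ includes that $\phi_F$ takes values in $\underline{\mathbb{A}}_F$ (which means that $\mu$ is compatible). *)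

theory Defs
  imports Main
begin

section \<open>Categories, functors and natural transformations\<close>

record ('o, 'm) category =
  Obj :: "'o set"
  Arr :: "'m set"
  Dom :: "'m \<Rightarrow> 'o"
  Cod :: "'m \<Rightarrow> 'o"
  Ident :: "'o \<Rightarrow> 'm"
  Comp :: "'m \<Rightarrow> 'm \<Rightarrow> 'm"  (infixr "\<cdot>\<index>" 70)

definition Mor :: "('o, 'm, 'z) category_scheme \<Rightarrow> 'o \<Rightarrow> 'o \<Rightarrow> 'm set" where
  "Mor C a b = {f \<in> Arr C. Dom C f = a \<and> Cod C f = b}"

locale category =
  fixes C :: "('o, 'm, 'z) category_scheme" (structure)
  assumes Dom_Obj: "f \<in> Arr C \<Longrightarrow> Dom C f \<in> Obj C"
    and Cod_Obj: "f \<in> Arr C \<Longrightarrow> Cod C f \<in> Obj C"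
    and Ident_Mor: "a \<in> Obj C \<Longrightarrow> Ident C a \<in> Mor C a a"
    and Comp_Mor: "f \<in> Mor C a b \<Longrightarrow> g \<in> Mor C b c \<Longrightarrow> g \<cdot> f \<in> Mor C a c"
    and Comp_assoc: "f \<in> Mor C a b \<Longrightarrow> g \<in> Mor C b c \<Longrightarrow> h \<in> Mor C c d \<Longrightarrow>
          (h \<cdot> g) \<cdot> f = h \<cdot> (g \<cdot> f)"
    and Comp_Ident_right: "f \<in> Mor C a b \<Longrightarrow> f \<cdot> Ident C a = f"
    and Comp_Ident_left: "f \<in> Mor C a b \<Longrightarrow> Ident C b \<cdot> f = f"

record ('o, 'm, 'p, 'n) func =
  fobj :: "'o \<Rightarrow> 'p"
  farr :: "'m \<Rightarrow> 'n"

locale cfunctor =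
  source: category C + target: category D
  for C :: "('o, 'm, 'y) category_scheme"
    and D :: "('p, 'n, 'z) category_scheme"
    and F :: "('o, 'm, 'p, 'n) func" +
  assumes fobj_Obj: "a \<in> Obj C \<Longrightarrow> fobj F a \<in> Obj D"
    and farr_Mor: "f \<in> Mor C a b \<Longrightarrow> farr F f \<in> Mor D (fobj F a) (fobj F b)"
    and farr_Ident: "a \<in> Obj C \<Longrightarrow> farr F (Ident C a) = Ident D (fobj F a)"
    and farr_Comp: "f \<in> Mor C a b \<Longrightarrow> g \<in> Mor C b c \<Longrightarrow>
          farr F (g \<cdot>\<^bsub>C\<^esub> f) = farr F g \<cdot>\<^bsub>D\<^esub> farr F f"

definition id_func :: "('o, 'm, 'o, 'm) func" where
  "id_func = \<lparr>fobj = (\<lambda>a. a), farr = (\<lambda>f. f)\<rparr>"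

definition comp_func ::
  "('p, 'n, 'q, 'k) func \<Rightarrow> ('o, 'm, 'p, 'n) func \<Rightarrow> ('o, 'm, 'q, 'k) func" where
  "comp_func G F = \<lparr>fobj = fobj G \<circ> fobj F, farr = farr G \<circ> farr F\<rparr>"

locale nat_trans =
  S: cfunctor C D F + T: cfunctor C D G
  for C :: "('o, 'm, 'y) category_scheme"
    and D :: "('p, 'n, 'z) category_scheme"
    and F G :: "('o, 'm, 'p, 'n) func"
    and \<tau> :: "'o \<Rightarrow> 'n" +
  assumes component: "a \<in> Obj C \<Longrightarrow> \<tau> a \<in> Mor D (fobj F a) (fobj G a)"
    and naturality: "f \<in> Mor C a b \<Longrightarrow>
          farr G f \<cdot>\<^bsub>D\<^esub> \<tau> a = \<tau> b \<cdot>\<^bsub>D\<^esub> farr F f"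


section \<open>Pairings of functors\<close>

locale pairing =
  left: cfunctor A B L + right: cfunctor B A R
  for A :: "('o, 'm, 'y) category_scheme"
    and B :: "('p, 'n, 'z) category_scheme"
    and L :: "('o, 'm, 'p, 'n) func"
    and R :: "('p, 'n, 'o, 'm) func"
    and \<alpha> :: "'o \<Rightarrow> 'p \<Rightarrow> 'n \<Rightarrow> 'm"
    and \<beta> :: "'o \<Rightarrow> 'p \<Rightarrow> 'm \<Rightarrow> 'n" +
  assumes \<alpha>_Mor: "a \<in> Obj A \<Longrightarrow> b \<in> Obj B \<Longrightarrow> f \<in> Mor B (fobj L a) b \<Longrightarrow>
          \<alpha> a b f \<in> Mor A a (fobj R b)"
    and \<beta>_Mor: "a \<in> Obj A \<Longrightarrow> b \<in> Obj B \<Longrightarrow> g \<in> Mor A a (fobj R b) \<Longrightarrow>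
          \<beta> a b g \<in> Mor B (fobj L a) b"
    and \<alpha>_natural: "h \<in> Mor A a' a \<Longrightarrow> k \<in> Mor B b b' \<Longrightarrow> f \<in> Mor B (fobj L a) b \<Longrightarrow>
          \<alpha> a' b' (k \<cdot>\<^bsub>B\<^esub> f \<cdot>\<^bsub>B\<^esub> farr L h) = farr R k \<cdot>\<^bsub>A\<^esub> \<alpha> a b f \<cdot>\<^bsub>A\<^esub> h"
    and \<beta>_natural: "h \<in> Mor A a' a \<Longrightarrow> k \<in> Mor B b b' \<Longrightarrow> g \<in> Mor A a (fobj R b) \<Longrightarrow>
          \<beta> a' b' (farr R k \<cdot>\<^bsub>A\<^esub> g \<cdot>\<^bsub>A\<^esub> h) = k \<cdot>\<^bsub>B\<^esub> \<beta> a b g \<cdot>\<^bsub>B\<^esub> farr L h"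

locale regular_pairing = pairing +
  assumes \<alpha>_regular: "a \<in> Obj A \<Longrightarrow> b \<in> Obj B \<Longrightarrow> f \<in> Mor B (fobj L a) b \<Longrightarrow>
          \<alpha> a b (\<beta> a b (\<alpha> a b f)) = \<alpha> a b f"
    and \<beta>_regular: "a \<in> Obj A \<Longrightarrow> b \<in> Obj B \<Longrightarrow> g \<in> Mor A a (fobj R b) \<Longrightarrow>
          \<beta> a b (\<alpha> a b (\<beta> a b g)) = \<beta> a b g"

definition quasi_unit ::
  "('p, 'n, 'z) category_scheme \<Rightarrow> ('o, 'm, 'p, 'n) func \<Rightarrow> ('o \<Rightarrow> 'p \<Rightarrow> 'n \<Rightarrow> 'm) \<Rightarrow> 'o \<Rightarrow> 'm" where
  "quasi_unit B L \<alpha> a = \<alpha> a (fobj L a) (Ident B (fobj L a))"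

definition quasi_counit ::
  "('o, 'm, 'y) category_scheme \<Rightarrow> ('p, 'n, 'o, 'm) func \<Rightarrow> ('o \<Rightarrow> 'p \<Rightarrow> 'm \<Rightarrow> 'n) \<Rightarrow> 'p \<Rightarrow> 'n" where
  "quasi_counit A R \<beta> b = \<beta> (fobj R b) b (Ident A (fobj R b))"

text \<open>Componentwise form of \<open>R\<epsilon>L \<cdot> RL\<eta> = R\<epsilon>L \<cdot> \<eta>RL\<close>.\<close>

definition symmetric_\<alpha> ::
  "('o, 'm, 'y) category_scheme \<Rightarrow> ('p, 'n, 'z) category_scheme \<Rightarrow>
   ('o, 'm, 'p, 'n) func \<Rightarrow> ('p, 'n, 'o, 'm) func \<Rightarrow>
   ('o \<Rightarrow> 'p \<Rightarrow> 'n \<Rightarrow> 'm) \<Rightarrow> ('o \<Rightarrow> 'p \<Rightarrow> 'm \<Rightarrow> 'n) \<Rightarrow> bool" where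
  "symmetric_\<alpha> A B L R \<alpha> \<beta> \<longleftrightarrow> (\<forall>a\<in>Obj A.
     farr R (quasi_counit A R \<beta> (fobj L a)) \<cdot>\<^bsub>A\<^esub> farr R (farr L (quasi_unit B L \<alpha> a)) =
     farr R (quasi_counit A R \<beta> (fobj L a)) \<cdot>\<^bsub>A\<^esub> quasi_unit B L \<alpha> (fobj R (fobj L a)))"


section \<open>q-unital monads\<close>

locale q_unital_monad =
  endo: cfunctor A A F +
  mult: nat_trans A A "comp_func F F" F \<mu> +
  quasiunit: nat_trans A A id_func F \<eta>
  for A :: "('o, 'm, 'z) category_scheme" (structure)
    and F :: "('o, 'm, 'o, 'm) func"
    and \<mu> :: "'o \<Rightarrow> 'm"
    and \<eta> :: "'o \<Rightarrow> 'm" +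
  assumes \<mu>_assoc: "a \<in> Obj A \<Longrightarrow> \<mu> a \<cdot> farr F (\<mu> a) = \<mu> a \<cdot> \<mu> (fobj F a)"

definition regular_\<eta> ::
  "('o, 'm, 'z) category_scheme \<Rightarrow> ('o, 'm, 'o, 'm) func \<Rightarrow> ('o \<Rightarrow> 'm) \<Rightarrow> ('o \<Rightarrow> 'm) \<Rightarrow> bool" where
  "regular_\<eta> A F \<mu> \<eta> \<longleftrightarrow> (\<forall>a\<in>Obj A. \<mu> a \<cdot>\<^bsub>A\<^esub> farr F (\<eta> a) \<cdot>\<^bsub>A\<^esub> \<eta> a = \<eta> a)"

definition symmetric_\<eta> ::
  "('o, 'm, 'z) category_scheme \<Rightarrow> ('o, 'm, 'o, 'm) func \<Rightarrow> ('o \<Rightarrow> 'm) \<Rightarrow> ('o \<Rightarrow> 'm) \<Rightarrow> bool" where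
  "symmetric_\<eta> A F \<mu> \<eta> \<longleftrightarrow>
     (\<forall>a\<in>Obj A. \<mu> a \<cdot>\<^bsub>A\<^esub> farr F (\<eta> a) = \<mu> a \<cdot>\<^bsub>A\<^esub> \<eta> (fobj F a))"

definition compatible_\<mu> ::
  "('o, 'm, 'z) category_scheme \<Rightarrow> ('o, 'm, 'o, 'm) func \<Rightarrow> ('o \<Rightarrow> 'm) \<Rightarrow> ('o \<Rightarrow> 'm) \<Rightarrow> bool" where
  "compatible_\<mu> A F \<mu> \<eta> \<longleftrightarrow>
     (\<forall>a\<in>Obj A. \<mu> a = \<mu> a \<cdot>\<^bsub>A\<^esub> \<mu> (fobj F a) \<cdot>\<^bsub>A\<^esub> farr F (\<eta> (fobj F a)))"

locale r_unital_monad = q_unital_monad +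
  assumes regular: "regular_\<eta> A F \<mu> \<eta>"
    and compatible: "compatible_\<mu> A F \<mu> \<eta>"

locale weak_monad = r_unital_monad +
  assumes symmetric: "symmetric_\<eta> A F \<mu> \<eta>"


section \<open>Modules over a q-unital monad\<close>

definition nonunital_modules ::
  "('o, 'm, 'z) category_scheme \<Rightarrow> ('o, 'm, 'o, 'm) func \<Rightarrow> ('o \<Rightarrow> 'm) \<Rightarrow> ('o \<times> 'm) set" where
  "nonunital_modules A F \<mu> = {(a, \<rho>). a \<in> Obj A \<and> \<rho> \<in> Mor A (fobj F a) a \<and>
     \<rho> \<cdot>\<^bsub>A\<^esub> farr F \<rho> = \<rho> \<cdot>\<^bsub>A\<^esub> \<mu> a}"

definition compatible_modules ::
  "('o, 'm, 'z) category_scheme \<Rightarrow> ('o, 'm, 'o, 'm) func \<Rightarrow> ('o \<Rightarrow> 'm) \<Rightarrow> ('o \<Rightarrow> 'm) \<Rightarrow>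
   ('o \<times> 'm) set" where
  "compatible_modules A F \<mu> \<eta> = {(a, \<rho>) \<in> nonunital_modules A F \<mu>.
     \<rho> = \<rho> \<cdot>\<^bsub>A\<^esub> \<mu> a \<cdot>\<^bsub>A\<^esub> farr F (\<eta> a)}"

definition module_Mor ::
  "('o, 'm, 'z) category_scheme \<Rightarrow> ('o, 'm, 'o, 'm) func \<Rightarrow> 'o \<times> 'm \<Rightarrow> 'o \<times> 'm \<Rightarrow> 'm set" where
  "module_Mor A F M N = {f \<in> Mor A (fst M) (fst N).
     snd N \<cdot>\<^bsub>A\<^esub> farr F f = f \<cdot>\<^bsub>A\<^esub> snd M}"

text \<open>One arrow of \<open>A\<close> may be a morphism between several pairs of modules, so an arrow of
  the category of compatible modules is a triple \<open>(M, f, N)\<close> recording its domain and codomain.\<close>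

type_synonym ('o, 'm) module_arr = "('o \<times> 'm) \<times> 'm \<times> ('o \<times> 'm)"

definition compatible_module_cat ::
  "('o, 'm, 'z) category_scheme \<Rightarrow> ('o, 'm, 'o, 'm) func \<Rightarrow> ('o \<Rightarrow> 'm) \<Rightarrow> ('o \<Rightarrow> 'm) \<Rightarrow>
   ('o \<times> 'm, ('o, 'm) module_arr) category" where
  "compatible_module_cat A F \<mu> \<eta> =
    \<lparr>Obj = compatible_modules A F \<mu> \<eta>,
     Arr = {(M, f, N). M \<in> compatible_modules A F \<mu> \<eta> \<and> N \<in> compatible_modules A F \<mu> \<eta> \<and>
              f \<in> module_Mor A F M N},
     Dom = (\<lambda>(M, f, N). M),
     Cod = (\<lambda>(M, f, N). N),
     Ident = (\<lambda>M. (M, Ident A (fst M), M)),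
     Comp = (\<lambda>(N', g, P) (M, f, N). (M, g \<cdot>\<^bsub>A\<^esub> f, P))\<rparr>"

definition free_func ::
  "('o, 'm, 'z) category_scheme \<Rightarrow> ('o, 'm, 'o, 'm) func \<Rightarrow> ('o \<Rightarrow> 'm) \<Rightarrow>
   ('o, 'm, 'o \<times> 'm, ('o, 'm) module_arr) func" where
  "free_func A F \<mu> =
    \<lparr>fobj = (\<lambda>a. (fobj F a, \<mu> a)),
     farr = (\<lambda>f. ((fobj F (Dom A f), \<mu> (Dom A f)), farr F f, (fobj F (Cod A f), \<mu> (Cod A f))))\<rparr>"

definition forgetful_func :: "('o \<times> 'm, ('o, 'm) module_arr, 'o, 'm) func" where
  "forgetful_func = \<lparr>fobj = (\<lambda>(a, \<rho>). a), farr = (\<lambda>(M, f, N). f)\<rparr>"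

definition \<alpha>\<^sub>F ::
  "('o, 'm, 'z) category_scheme \<Rightarrow> ('o \<Rightarrow> 'm) \<Rightarrow>
   'o \<Rightarrow> 'o \<times> 'm \<Rightarrow> ('o, 'm) module_arr \<Rightarrow> 'm" where
  "\<alpha>\<^sub>F A \<eta> a N = (\<lambda>(M, f, N'). f \<cdot>\<^bsub>A\<^esub> \<eta> a)"

definition \<beta>\<^sub>F ::
  "('o, 'm, 'z) category_scheme \<Rightarrow> ('o, 'm, 'o, 'm) func \<Rightarrow> ('o \<Rightarrow> 'm) \<Rightarrow>
   'o \<Rightarrow> 'o \<times> 'm \<Rightarrow> 'm \<Rightarrow> ('o, 'm) module_arr" where
  "\<beta>\<^sub>F A F \<mu> a N = (\<lambda>g. ((fobj F a, \<mu> a), snd N \<cdot>\<^bsub>A\<^esub> farr F g, N))"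

end

theory Submission
  imports Defs
begin

text \<open>
  The compatible modules of any q-unital monad form a category with a forgetful functor to \<open>A\<close>
  (\<open>category_compatible_modules\<close>, \<open>forgetful_functor\<close>). The free module \<open>(F a, \<mu> a)\<close> is
  compatible for all \<open>a\<close> exactly when \<open>\<mu>\<close> is compatible, since the two conditions are the same
  equation. When they hold, the free and forgetful functors with \<open>\<alpha>\<^sub>F\<close> and \<open>\<beta>\<^sub>F\<close> form a pairing
  (\<open>pairing_if_compatible_\<mu>\<close>), by naturality of \<open>\<mu>\<close> and \<open>\<eta>\<close> and the equations for modules and
  their morphisms.

  Regularity of the pairing comes from two computations. For a module morphism \<open>f\<close> from the
  free module on \<open>a\<close> to a module \<open>(b, \<rho>)\<close>,
  \<open>\<alpha> (\<beta> (\<alpha> f)) = \<rho> \<cdot> F (f \<cdot> \<eta> a) \<cdot> \<eta> a = f \<cdot> (\<mu> a \<cdot> F (\<eta> a) \<cdot> \<eta> a)\<close> (\<open>\<alpha>_\<beta>_\<alpha>\<close>), so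
  regularity of \<open>\<eta>\<close> yields \<open>\<alpha> \<beta> \<alpha> = \<alpha>\<close>; taking \<open>f\<close> to be the identity of the free module gives
  the converse (\<open>r_unital_if_regular_pairing\<close>). For \<open>g\<close> from \<open>a\<close> to a module \<open>(b, \<rho>)\<close>,
  \<open>\<beta> (\<alpha> (\<beta> g)) = \<rho> \<cdot> F (\<rho> \<cdot> F g \<cdot> \<eta> a) = (\<rho> \<cdot> \<mu> b \<cdot> F (\<eta> b)) \<cdot> F g\<close>, so
  \<open>\<beta> \<alpha> \<beta> = \<beta>\<close> holds automatically, because \<open>(b, \<rho>)\<close> is compatible (\<open>\<beta>_\<alpha>_\<beta>\<close>).

  Finally, the quasi-unit of the pairing at \<open>a\<close> is \<open>\<eta> a\<close>, and the quasi-counit at the free module on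
  \<open>a\<close> has underlying arrow \<open>\<mu> a\<close>, so symmetry of \<open>\<alpha>\<^sub>F\<close> is symmetry of \<open>\<eta>\<close>
  (\<open>symmetric_\<alpha>_iff_symmetric_\<eta>\<close>).
\<close>

section \<open>The category of compatible modules\<close>

lemma Obj_compatible_module_cat [simp]:
  "Obj (compatible_module_cat A F \<mu> \<eta>) = compatible_modules A F \<mu> \<eta>"
  by (simp add: compatible_module_cat_def)

lemma Ident_compatible_module_cat [simp]:
  "Ident (compatible_module_cat A F \<mu> \<eta>) M = (M, Ident A (fst M), M)"
  by (simp add: compatible_module_cat_def)

lemma Comp_compatible_module_cat [simp]:
  "(N', g, P) \<cdot>\<^bsub>compatible_module_cat A F \<mu> \<eta>\<^esub> (M, f, N) = (M, g \<cdot>\<^bsub>A\<^esub> f, P)"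
  by (simp add: compatible_module_cat_def)

lemma Mor_compatible_module_cat:
  "h \<in> Mor (compatible_module_cat A F \<mu> \<eta>) M N \<longleftrightarrow>
     M \<in> compatible_modules A F \<mu> \<eta> \<and> N \<in> compatible_modules A F \<mu> \<eta> \<and>
     (\<exists>f \<in> module_Mor A F M N. h = (M, f, N))"
  by (auto simp: compatible_module_cat_def Mor_def)

lemma Mor_compatible_module_catE:
  assumes "h \<in> Mor (compatible_module_cat A F \<mu> \<eta>) M N"
  obtains f where "h = (M, f, N)" "f \<in> module_Mor A F M N"
    "M \<in> compatible_modules A F \<mu> \<eta>" "N \<in> compatible_modules A F \<mu> \<eta>"
  using assms by (auto simp: Mor_compatible_module_cat)

lemma module_MorD:
  assumes "f \<in> module_Mor A F (a, \<rho>) (b, \<sigma>)"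
  shows "f \<in> Mor A a b" "\<sigma> \<cdot>\<^bsub>A\<^esub> farr F f = f \<cdot>\<^bsub>A\<^esub> \<rho>"
  using assms by (auto simp: module_Mor_def)

lemma compatible_modulesD:
  assumes "(a, \<rho>) \<in> compatible_modules A F \<mu> \<eta>"
  shows "a \<in> Obj A" "\<rho> \<in> Mor A (fobj F a) a"
    "\<rho> \<cdot>\<^bsub>A\<^esub> farr F \<rho> = \<rho> \<cdot>\<^bsub>A\<^esub> \<mu> a"
    "\<rho> \<cdot>\<^bsub>A\<^esub> \<mu> a \<cdot>\<^bsub>A\<^esub> farr F (\<eta> a) = \<rho>"
  using assms by (auto simp: compatible_modules_def nonunital_modules_def)

lemma (in category) Obj_of_Mor:
  assumes "f \<in> Mor C a b"
  shows "a \<in> Obj C" "b \<in> Obj C"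
  using assms Dom_Obj Cod_Obj by (auto simp: Mor_def)

lemma free_modules_compatible_iff_compatible_\<mu>:
  assumes "q_unital_monad A F \<mu> \<eta>"
  shows "(\<forall>a\<in>Obj A. (fobj F a, \<mu> a) \<in> compatible_modules A F \<mu> \<eta>) \<longleftrightarrow> compatible_\<mu> A F \<mu> \<eta>"
proof -
  interpret q_unital_monad A F \<mu> \<eta> by fact
  have "(fobj F a, \<mu> a) \<in> nonunital_modules A F \<mu>" if "a \<in> Obj A" for a
    using that endo.fobj_Obj mult.component[OF that] \<mu>_assoc[OF that]
    by (simp add: nonunital_modules_def comp_func_def)
  then show ?thesis
    by (auto simp: compatible_modules_def compatible_\<mu>_def)
qed

context q_unital_monad
begin

lemma \<mu>_Mor: "a \<in> Obj A \<Longrightarrow> \<mu> a \<in> Mor A (fobj F (fobj F a)) (fobj F a)"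
  using mult.component by (simp add: comp_func_def)

lemma \<eta>_Mor: "a \<in> Obj A \<Longrightarrow> \<eta> a \<in> Mor A a (fobj F a)"
  using quasiunit.component by (simp add: id_func_def)

lemma \<mu>_naturality: "f \<in> Mor A a b \<Longrightarrow> \<mu> b \<cdot> farr F (farr F f) = farr F f \<cdot> \<mu> a"
  using mult.naturality[of f a b] by (simp add: comp_func_def)

lemma \<eta>_naturality: "f \<in> Mor A a b \<Longrightarrow> \<eta> b \<cdot> f = farr F f \<cdot> \<eta> a"
  using quasiunit.naturality[of f a b] by (simp add: id_func_def)

lemmas Comp_assoc = endo.source.Comp_assoc
lemmas Comp_Mor = endo.source.Comp_Mor
lemmas Obj_of_Mor = endo.source.Obj_of_Mor

lemma module_Mor_Ident:
  assumes "(a, \<rho>) \<in> compatible_modules A F \<mu> \<eta>"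
  shows "Ident A a \<in> module_Mor A F (a, \<rho>) (a, \<rho>)"
  using compatible_modulesD(1,2)[OF assms] endo.farr_Ident endo.source.Comp_Ident_left
    endo.source.Comp_Ident_right endo.source.Ident_Mor
  by (simp add: module_Mor_def)

lemma module_Mor_Comp:
  assumes f: "f \<in> module_Mor A F (a, \<rho>) (b, \<sigma>)"
    and g: "g \<in> module_Mor A F (b, \<sigma>) (c, \<tau>)"
    and \<rho>: "\<rho> \<in> Mor A (fobj F a) a"
    and \<sigma>: "\<sigma> \<in> Mor A (fobj F b) b"
    and \<tau>: "\<tau> \<in> Mor A (fobj F c) c"
  shows "g \<cdot> f \<in> module_Mor A F (a, \<rho>) (c, \<tau>)"
proof -
  note fm = module_MorD[OF f] and gm = module_MorD[OF g]
  have Ff: "farr F f \<in> Mor A (fobj F a) (fobj F b)"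
    and Fg: "farr F g \<in> Mor A (fobj F b) (fobj F c)"
    using fm gm endo.farr_Mor by auto
  have "\<tau> \<cdot> farr F (g \<cdot> f) = \<tau> \<cdot> (farr F g \<cdot> farr F f)"
    using fm gm endo.farr_Comp by simp
  also have "\<dots> = (\<tau> \<cdot> farr F g) \<cdot> farr F f"
    using Comp_assoc[OF Ff Fg \<tau>] by simp
  also have "\<dots> = g \<cdot> (\<sigma> \<cdot> farr F f)"
    using Comp_assoc[OF Ff \<sigma> gm(1)] gm(2) by simp
  also have "\<dots> = (g \<cdot> f) \<cdot> \<rho>"
    using Comp_assoc[OF \<rho> fm(1) gm(1)] fm(2) by simp
  finally show ?thesis
    using Comp_Mor[OF fm(1) gm(1)] by (simp add: module_Mor_def)
qed

lemma category_compatible_modules: "category (compatible_module_cat A F \<mu> \<eta>)"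
proof
  fix h
  assume "h \<in> Arr (compatible_module_cat A F \<mu> \<eta>)"
  then show "Dom (compatible_module_cat A F \<mu> \<eta>) h \<in> Obj (compatible_module_cat A F \<mu> \<eta>)"
    and "Cod (compatible_module_cat A F \<mu> \<eta>) h \<in> Obj (compatible_module_cat A F \<mu> \<eta>)"
    by (auto simp: compatible_module_cat_def)
next
  fix M
  assume "M \<in> Obj (compatible_module_cat A F \<mu> \<eta>)"
  then show "Ident (compatible_module_cat A F \<mu> \<eta>) M \<in> Mor (compatible_module_cat A F \<mu> \<eta>) M M"
    using module_Mor_Ident by (cases M) (simp add: Mor_compatible_module_cat)
next
  fix f g M N P
  assume "f \<in> Mor (compatible_module_cat A F \<mu> \<eta>) M N"
    and "g \<in> Mor (compatible_module_cat A F \<mu> \<eta>) N P"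
  then show "g \<cdot>\<^bsub>compatible_module_cat A F \<mu> \<eta>\<^esub> f \<in> Mor (compatible_module_cat A F \<mu> \<eta>) M P"
    using compatible_modulesD(2)
    by (cases M; cases N; cases P)
      (auto simp: Mor_compatible_module_cat intro!: module_Mor_Comp)
next
  fix f g h M N P Q
  assume "f \<in> Mor (compatible_module_cat A F \<mu> \<eta>) M N"
    and "g \<in> Mor (compatible_module_cat A F \<mu> \<eta>) N P"
    and "h \<in> Mor (compatible_module_cat A F \<mu> \<eta>) P Q"
  then show "(h \<cdot>\<^bsub>compatible_module_cat A F \<mu> \<eta>\<^esub> g) \<cdot>\<^bsub>compatible_module_cat A F \<mu> \<eta>\<^esub> f =
      h \<cdot>\<^bsub>compatible_module_cat A F \<mu> \<eta>\<^esub> (g \<cdot>\<^bsub>compatible_module_cat A F \<mu> \<eta>\<^esub> f)"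
    by (auto elim!: Mor_compatible_module_catE simp: module_Mor_def intro: Comp_assoc)
next
  fix f M N
  assume "f \<in> Mor (compatible_module_cat A F \<mu> \<eta>) M N"
  then show
    "f \<cdot>\<^bsub>compatible_module_cat A F \<mu> \<eta>\<^esub> Ident (compatible_module_cat A F \<mu> \<eta>) M = f"
    "Ident (compatible_module_cat A F \<mu> \<eta>) N \<cdot>\<^bsub>compatible_module_cat A F \<mu> \<eta>\<^esub> f = f"
    using endo.source.Comp_Ident_left endo.source.Comp_Ident_right
    by (auto elim!: Mor_compatible_module_catE simp: module_Mor_def)
qed

section \<open>The free and forgetful functors\<close>

lemma forgetful_functor: "cfunctor (compatible_module_cat A F \<mu> \<eta>) A forgetful_func"
proof (intro cfunctor.intro cfunctor_axioms.intro)
  show "category (compatible_module_cat A F \<mu> \<eta>)" by (rule category_compatible_modules)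
  show "category A" by unfold_locales
qed (auto simp: forgetful_func_def Mor_compatible_module_cat module_Mor_def
    dest: compatible_modulesD(1))

lemma free_functor:
  assumes "compatible_\<mu> A F \<mu> \<eta>"
  shows "cfunctor A (compatible_module_cat A F \<mu> \<eta>) (free_func A F \<mu>)"
proof -
  have free: "(fobj F a, \<mu> a) \<in> compatible_modules A F \<mu> \<eta>" if "a \<in> Obj A" for a
    using assms that free_modules_compatible_iff_compatible_\<mu> q_unital_monad_axioms by blast
  show ?thesis
  proof (intro cfunctor.intro cfunctor_axioms.intro)
    show "category (compatible_module_cat A F \<mu> \<eta>)" by (rule category_compatible_modules)
    show "category A" by unfold_locales
  next
    fix a
    assume a: "a \<in> Obj A"
    then show "fobj (free_func A F \<mu>) a \<in> Obj (compatible_module_cat A F \<mu> \<eta>)"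
      using free by (simp add: free_func_def)
    show "farr (free_func A F \<mu>) (Ident A a) =
        Ident (compatible_module_cat A F \<mu> \<eta>) (fobj (free_func A F \<mu>) a)"
      using endo.source.Ident_Mor[OF a] endo.farr_Ident[OF a]
      by (simp add: free_func_def Mor_def)
  next
    fix f a b
    assume f: "f \<in> Mor A a b"
    then show "farr (free_func A F \<mu>) f \<in>
        Mor (compatible_module_cat A F \<mu> \<eta>) (fobj (free_func A F \<mu>) a) (fobj (free_func A F \<mu>) b)"
      using free Obj_of_Mor[OF f] \<mu>_naturality[OF f] endo.farr_Mor[OF f]
      by (auto simp: free_func_def Mor_compatible_module_cat module_Mor_def) (auto simp: Mor_def)
    fix g c
    assume g: "g \<in> Mor A b c"
    show "farr (free_func A F \<mu>) (g \<cdot> f) =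
        farr (free_func A F \<mu>) g \<cdot>\<^bsub>compatible_module_cat A F \<mu> \<eta>\<^esub> farr (free_func A F \<mu>) f"
      using f g Comp_Mor[OF f g] endo.farr_Comp[OF f g] by (simp add: free_func_def Mor_def)
  qed
qed

section \<open>The pairing of the free and forgetful functors\<close>

text \<open>The values of \<open>\<beta>\<^sub>F\<close> are module morphisms on the free module.\<close>

lemma module_Mor_extension:
  assumes M: "(b, \<rho>) \<in> compatible_modules A F \<mu> \<eta>" and g: "g \<in> Mor A a b"
  shows "\<rho> \<cdot> farr F g \<in> module_Mor A F (fobj F a, \<mu> a) (b, \<rho>)"
proof -
  note m = compatible_modulesD[OF M]
  note Fg = endo.farr_Mor[OF g]
  note \<mu>a = \<mu>_Mor[OF Obj_of_Mor(1)[OF g]] and \<mu>b = \<mu>_Mor[OF Obj_of_Mor(2)[OF g]]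
  have "\<rho> \<cdot> farr F (\<rho> \<cdot> farr F g) = \<rho> \<cdot> (farr F \<rho> \<cdot> farr F (farr F g))"
    using endo.farr_Comp[OF Fg m(2)] by simp
  also have "\<dots> = (\<rho> \<cdot> \<mu> b) \<cdot> farr F (farr F g)"
    using Comp_assoc[OF endo.farr_Mor[OF Fg] endo.farr_Mor[OF m(2)] m(2)] m(3) by simp
  also have "\<dots> = \<rho> \<cdot> (farr F g \<cdot> \<mu> a)"
    using Comp_assoc[OF endo.farr_Mor[OF Fg] \<mu>b m(2)] \<mu>_naturality[OF g] by simp
  also have "\<dots> = (\<rho> \<cdot> farr F g) \<cdot> \<mu> a"
    using Comp_assoc[OF \<mu>a Fg m(2)] by simp
  finally show ?thesis
    using Comp_Mor[OF Fg m(2)] by (simp add: module_Mor_def)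
qed

lemma pairing_if_compatible_\<mu>:
  assumes "compatible_\<mu> A F \<mu> \<eta>"
  shows "pairing A (compatible_module_cat A F \<mu> \<eta>) (free_func A F \<mu>) forgetful_func
    (\<alpha>\<^sub>F A \<eta>) (\<beta>\<^sub>F A F \<mu>)"
proof (intro pairing.intro pairing_axioms.intro)
  show "cfunctor A (compatible_module_cat A F \<mu> \<eta>) (free_func A F \<mu>)"
    using assms by (rule free_functor)
  show "cfunctor (compatible_module_cat A F \<mu> \<eta>) A forgetful_func"
    by (rule forgetful_functor)
next
  fix a N h
  assume "a \<in> Obj A" "h \<in> Mor (compatible_module_cat A F \<mu> \<eta>) (fobj (free_func A F \<mu>) a) N"
  then show "\<alpha>\<^sub>F A \<eta> a N h \<in> Mor A a (fobj forgetful_func N)"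
    by (auto elim!: Mor_compatible_module_catE intro: Comp_Mor \<eta>_Mor
        simp: \<alpha>\<^sub>F_def forgetful_func_def free_func_def module_Mor_def split: prod.splits)
next
  fix a N g
  assume a: "a \<in> Obj A" and N: "N \<in> Obj (compatible_module_cat A F \<mu> \<eta>)"
    and g: "g \<in> Mor A a (fobj forgetful_func N)"
  obtain b \<rho> where [simp]: "N = (b, \<rho>)" by (cases N)
  have "(fobj F a, \<mu> a) \<in> compatible_modules A F \<mu> \<eta>"
    using assms a free_modules_compatible_iff_compatible_\<mu> q_unital_monad_axioms by blast
  then show "\<beta>\<^sub>F A F \<mu> a N g \<in> Mor (compatible_module_cat A F \<mu> \<eta>) (fobj (free_func A F \<mu>) a) N"
    using N g module_Mor_extension
    by (auto simp: \<beta>\<^sub>F_def forgetful_func_def free_func_def Mor_compatible_module_cat)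
next
  fix h a' a k N N' f
  assume h: "h \<in> Mor A a' a" and k: "k \<in> Mor (compatible_module_cat A F \<mu> \<eta>) N N'"
    and f: "f \<in> Mor (compatible_module_cat A F \<mu> \<eta>) (fobj (free_func A F \<mu>) a) N"
  obtain k' where k': "k = (N, k', N')" "k' \<in> Mor A (fst N) (fst N')"
    using k by (auto elim!: Mor_compatible_module_catE simp: module_Mor_def)
  obtain f' where f': "f = ((fobj F a, \<mu> a), f', N)" "f' \<in> Mor A (fobj F a) (fst N)"
    using f by (auto elim!: Mor_compatible_module_catE simp: module_Mor_def free_func_def)
  have dom: "Dom A h = a'" "Cod A h = a" using h by (auto simp: Mor_def)
  note Fh = endo.farr_Mor[OF h]
  note \<eta>a = \<eta>_Mor[OF Obj_of_Mor(2)[OF h]] and \<eta>a' = \<eta>_Mor[OF Obj_of_Mor(1)[OF h]]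
  have "(k' \<cdot> (f' \<cdot> farr F h)) \<cdot> \<eta> a' = k' \<cdot> (f' \<cdot> (farr F h \<cdot> \<eta> a'))"
    using Comp_assoc[OF \<eta>a' Comp_Mor[OF Fh f'(2)] k'(2)] Comp_assoc[OF \<eta>a' Fh f'(2)] by simp
  also have "\<dots> = k' \<cdot> ((f' \<cdot> \<eta> a) \<cdot> h)"
    using Comp_assoc[OF h \<eta>a f'(2)] \<eta>_naturality[OF h] by simp
  finally show "\<alpha>\<^sub>F A \<eta> a' N' (k \<cdot>\<^bsub>compatible_module_cat A F \<mu> \<eta>\<^esub>
        f \<cdot>\<^bsub>compatible_module_cat A F \<mu> \<eta>\<^esub> farr (free_func A F \<mu>) h) =
      farr forgetful_func k \<cdot> \<alpha>\<^sub>F A \<eta> a N f \<cdot> h"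
    by (simp add: k' f' dom \<alpha>\<^sub>F_def forgetful_func_def free_func_def)
next
  fix h a' a k N N' g
  assume h: "h \<in> Mor A a' a" and k: "k \<in> Mor (compatible_module_cat A F \<mu> \<eta>) N N'"
    and g: "g \<in> Mor A a (fobj forgetful_func N)"
  obtain b \<rho> b' \<rho>' where [simp]: "N = (b, \<rho>)" "N' = (b', \<rho>')" by (cases N; cases N')
  obtain k' where [simp]: "k = (N, k', N')" and k': "k' \<in> module_Mor A F (b, \<rho>) (b', \<rho>')"
    and N: "(b, \<rho>) \<in> compatible_modules A F \<mu> \<eta>" "(b', \<rho>') \<in> compatible_modules A F \<mu> \<eta>"
    using k by (auto elim!: Mor_compatible_module_catE)
  have dom: "Dom A h = a'" "Cod A h = a" using h by (auto simp: Mor_def)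
  have gb: "g \<in> Mor A a b" using g by (simp add: forgetful_func_def)
  note Fh = endo.farr_Mor[OF h] and Fg = endo.farr_Mor[OF gb]
    and km = module_MorD[OF k'] and m = compatible_modulesD(2)[OF N(1)]
    and m' = compatible_modulesD(2)[OF N(2)]
  note Fk = endo.farr_Mor[OF km(1)]
  have "\<rho>' \<cdot> farr F (k' \<cdot> (g \<cdot> h)) = \<rho>' \<cdot> (farr F k' \<cdot> (farr F g \<cdot> farr F h))"
    using endo.farr_Comp[OF Comp_Mor[OF h gb] km(1)] endo.farr_Comp[OF h gb] by simp
  also have "\<dots> = (k' \<cdot> \<rho>) \<cdot> (farr F g \<cdot> farr F h)"
    using Comp_assoc[OF Comp_Mor[OF Fh Fg] Fk m'] km(2) by simp
  also have "\<dots> = k' \<cdot> ((\<rho> \<cdot> farr F g) \<cdot> farr F h)"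
    using Comp_assoc[OF Comp_Mor[OF Fh Fg] m km(1)] Comp_assoc[OF Fh Fg m] by simp
  finally show "\<beta>\<^sub>F A F \<mu> a' N' (farr forgetful_func k \<cdot> g \<cdot> h) =
      k \<cdot>\<^bsub>compatible_module_cat A F \<mu> \<eta>\<^esub>
        \<beta>\<^sub>F A F \<mu> a N g \<cdot>\<^bsub>compatible_module_cat A F \<mu> \<eta>\<^esub> farr (free_func A F \<mu>) h"
    by (simp add: dom \<beta>\<^sub>F_def forgetful_func_def free_func_def)
qed

section \<open>Regularity and symmetry\<close>

text \<open>The left-hand side is \<open>\<alpha> (\<beta> (\<alpha> f))\<close>; on the right, regularity of \<open>\<eta>\<close> says that the second
  factor is \<open>\<eta> a\<close>.\<close>

lemma \<alpha>_\<beta>_\<alpha>: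
  assumes f: "f \<in> module_Mor A F (fobj F a, \<mu> a) (b, \<rho>)"
    and a: "a \<in> Obj A" and \<rho>: "\<rho> \<in> Mor A (fobj F b) b"
  shows "(\<rho> \<cdot> farr F (f \<cdot> \<eta> a)) \<cdot> \<eta> a = f \<cdot> (\<mu> a \<cdot> farr F (\<eta> a) \<cdot> \<eta> a)"
proof -
  note fm = module_MorD[OF f]
  note \<eta>a = \<eta>_Mor[OF a] and \<mu>a = \<mu>_Mor[OF a]
  note F\<eta> = endo.farr_Mor[OF \<eta>a] and Ff = endo.farr_Mor[OF fm(1)]
  have "(\<rho> \<cdot> farr F (f \<cdot> \<eta> a)) \<cdot> \<eta> a = (\<rho> \<cdot> (farr F f \<cdot> farr F (\<eta> a))) \<cdot> \<eta> a"
    using endo.farr_Comp[OF \<eta>a fm(1)] by simp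
  also have "\<dots> = ((f \<cdot> \<mu> a) \<cdot> farr F (\<eta> a)) \<cdot> \<eta> a"
    using Comp_assoc[OF F\<eta> Ff \<rho>] fm(2) by simp
  also have "\<dots> = f \<cdot> (\<mu> a \<cdot> farr F (\<eta> a) \<cdot> \<eta> a)"
    using Comp_assoc[OF \<eta>a F\<eta> Comp_Mor[OF \<mu>a fm(1)]]
      Comp_assoc[OF Comp_Mor[OF \<eta>a F\<eta>] \<mu>a fm(1)] by simp
  finally show ?thesis .
qed

text \<open>\<open>\<beta> \<alpha> \<beta> = \<beta>\<close> on underlying arrows. Regularity of \<open>\<eta>\<close> plays no role: naturality of \<open>\<eta>\<close> moves the
  unit past \<open>g\<close>, and compatibility of the target module absorbs it.\<close>

lemma \<beta>_\<alpha>_\<beta>: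
  assumes M: "(b, \<rho>) \<in> compatible_modules A F \<mu> \<eta>" and g: "g \<in> Mor A a b"
  shows "\<rho> \<cdot> farr F ((\<rho> \<cdot> farr F g) \<cdot> \<eta> a) = \<rho> \<cdot> farr F g"
proof -
  note m = compatible_modulesD[OF M]
  note Fg = endo.farr_Mor[OF g] and \<eta>a = \<eta>_Mor[OF Obj_of_Mor(1)[OF g]]
    and \<eta>b = \<eta>_Mor[OF m(1)] and \<mu>b = \<mu>_Mor[OF m(1)]
  note F\<eta> = endo.farr_Mor[OF \<eta>b] and F\<rho> = endo.farr_Mor[OF m(2)]
  have "(\<rho> \<cdot> farr F g) \<cdot> \<eta> a = \<rho> \<cdot> (\<eta> b \<cdot> g)"
    using Comp_assoc[OF \<eta>a Fg m(2)] \<eta>_naturality[OF g] by simp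
  then have "\<rho> \<cdot> farr F ((\<rho> \<cdot> farr F g) \<cdot> \<eta> a) = \<rho> \<cdot> (farr F \<rho> \<cdot> (farr F (\<eta> b) \<cdot> farr F g))"
    using endo.farr_Comp[OF Comp_Mor[OF g \<eta>b] m(2)] endo.farr_Comp[OF g \<eta>b] by simp
  also have "\<dots> = (\<rho> \<cdot> \<mu> b) \<cdot> (farr F (\<eta> b) \<cdot> farr F g)"
    using Comp_assoc[OF Comp_Mor[OF Fg F\<eta>] F\<rho> m(2)] m(3) by simp
  also have "\<dots> = (\<rho> \<cdot> \<mu> b \<cdot> farr F (\<eta> b)) \<cdot> farr F g"
    using Comp_assoc[OF Fg F\<eta> Comp_Mor[OF \<mu>b m(2)]] Comp_assoc[OF F\<eta> \<mu>b m(2)] by simp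
  also have "\<dots> = \<rho> \<cdot> farr F g"
    using m(4) by simp
  finally show ?thesis .
qed

lemma regular_pairing_if_r_unital:
  assumes "regular_\<eta> A F \<mu> \<eta>" "compatible_\<mu> A F \<mu> \<eta>"
  shows "regular_pairing A (compatible_module_cat A F \<mu> \<eta>) (free_func A F \<mu>) forgetful_func
    (\<alpha>\<^sub>F A \<eta>) (\<beta>\<^sub>F A F \<mu>)"
proof (intro regular_pairing.intro regular_pairing_axioms.intro pairing_if_compatible_\<mu> assms)
  fix a N h
  assume a: "a \<in> Obj A" and N: "N \<in> Obj (compatible_module_cat A F \<mu> \<eta>)"
    and h: "h \<in> Mor (compatible_module_cat A F \<mu> \<eta>) (fobj (free_func A F \<mu>) a) N"
  obtain b \<rho> where [simp]: "N = (b, \<rho>)" by (cases N)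
  obtain f where [simp]: "h = ((fobj F a, \<mu> a), f, N)"
    and f: "f \<in> module_Mor A F (fobj F a, \<mu> a) (b, \<rho>)"
    using h by (auto elim!: Mor_compatible_module_catE simp: free_func_def)
  have "(\<rho> \<cdot> farr F (f \<cdot> \<eta> a)) \<cdot> \<eta> a = f \<cdot> (\<mu> a \<cdot> farr F (\<eta> a) \<cdot> \<eta> a)"
    using f a N compatible_modulesD(2) by (auto intro!: \<alpha>_\<beta>_\<alpha>)
  then show "\<alpha>\<^sub>F A \<eta> a N (\<beta>\<^sub>F A F \<mu> a N (\<alpha>\<^sub>F A \<eta> a N h)) = \<alpha>\<^sub>F A \<eta> a N h"
    using assms(1) a by (simp add: \<alpha>\<^sub>F_def \<beta>\<^sub>F_def regular_\<eta>_def)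
next
  fix a N g
  assume "N \<in> Obj (compatible_module_cat A F \<mu> \<eta>)" "g \<in> Mor A a (fobj forgetful_func N)"
  then show "\<beta>\<^sub>F A F \<mu> a N (\<alpha>\<^sub>F A \<eta> a N (\<beta>\<^sub>F A F \<mu> a N g)) = \<beta>\<^sub>F A F \<mu> a N g"
    using \<beta>_\<alpha>_\<beta> by (cases N) (auto simp: \<alpha>\<^sub>F_def \<beta>\<^sub>F_def forgetful_func_def)
qed

text \<open>Regularity of \<open>\<eta>\<close> at \<open>a\<close> is \<open>\<alpha> \<beta> \<alpha> = \<alpha>\<close> at the identity of the free module on \<open>a\<close>.\<close>

lemma r_unital_if_regular_pairing:
  assumes "regular_pairing A (compatible_module_cat A F \<mu> \<eta>) (free_func A F \<mu>) forgetful_func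
    (\<alpha>\<^sub>F A \<eta>) (\<beta>\<^sub>F A F \<mu>)"
  shows "regular_\<eta> A F \<mu> \<eta>" "compatible_\<mu> A F \<mu> \<eta>"
proof -
  interpret P: regular_pairing A "compatible_module_cat A F \<mu> \<eta>" "free_func A F \<mu>"
    forgetful_func "\<alpha>\<^sub>F A \<eta>" "\<beta>\<^sub>F A F \<mu>"
    by fact
  have free: "(fobj F a, \<mu> a) \<in> compatible_modules A F \<mu> \<eta>" if "a \<in> Obj A" for a
    using P.left.fobj_Obj[OF that] by (simp add: free_func_def)
  then show "compatible_\<mu> A F \<mu> \<eta>"
    using free_modules_compatible_iff_compatible_\<mu> q_unital_monad_axioms by blast
  show "regular_\<eta> A F \<mu> \<eta>"
    unfolding regular_\<eta>_def
  proof
    fix a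
    assume a: "a \<in> Obj A"
    let ?M = "(fobj F a, \<mu> a)"
    note \<eta>a = \<eta>_Mor[OF a] and \<mu>a = \<mu>_Mor[OF a]
    note F\<eta> = endo.farr_Mor[OF \<eta>a]
    have "(?M, Ident A (fobj F a), ?M) \<in> Mor (compatible_module_cat A F \<mu> \<eta>) ?M ?M"
      using free[OF a] module_Mor_Ident by (simp add: Mor_compatible_module_cat)
    then have "(\<mu> a \<cdot> farr F (Ident A (fobj F a) \<cdot> \<eta> a)) \<cdot> \<eta> a = Ident A (fobj F a) \<cdot> \<eta> a"
      using P.\<alpha>_regular[OF a, of ?M "(?M, Ident A (fobj F a), ?M)"] free[OF a]
      by (simp add: \<alpha>\<^sub>F_def \<beta>\<^sub>F_def free_func_def)
    then show "\<mu> a \<cdot> farr F (\<eta> a) \<cdot> \<eta> a = \<eta> a"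
      using endo.source.Comp_Ident_left[OF \<eta>a] Comp_assoc[OF \<eta>a F\<eta> \<mu>a] by simp
  qed
qed

lemma symmetric_\<alpha>_iff_symmetric_\<eta>:
  "symmetric_\<alpha> A (compatible_module_cat A F \<mu> \<eta>) (free_func A F \<mu>) forgetful_func
    (\<alpha>\<^sub>F A \<eta>) (\<beta>\<^sub>F A F \<mu>) \<longleftrightarrow> symmetric_\<eta> A F \<mu> \<eta>"
proof -
  have unit: "quasi_unit (compatible_module_cat A F \<mu> \<eta>) (free_func A F \<mu>) (\<alpha>\<^sub>F A \<eta>) a = \<eta> a"
    if "a \<in> Obj A" for a
    using endo.source.Comp_Ident_left[OF \<eta>_Mor[OF that]]
    by (simp add: quasi_unit_def \<alpha>\<^sub>F_def free_func_def)
  have counit: "farr forgetful_func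
      (quasi_counit A forgetful_func (\<beta>\<^sub>F A F \<mu>) (fobj (free_func A F \<mu>) a)) = \<mu> a"
    if "a \<in> Obj A" for a
    using endo.source.Comp_Ident_right[OF \<mu>_Mor[OF that]] endo.farr_Ident[OF endo.fobj_Obj[OF that]]
    by (simp add: quasi_counit_def \<beta>\<^sub>F_def free_func_def forgetful_func_def)
  have "farr forgetful_func (farr (free_func A F \<mu>) f) = farr F f"
    and "fobj forgetful_func (fobj (free_func A F \<mu>) a) = fobj F a" for f a
    by (simp_all add: free_func_def forgetful_func_def)
  then show ?thesis
    using unit counit endo.fobj_Obj by (simp add: symmetric_\<alpha>_def symmetric_\<eta>_def)
qed

end

theorem proposition3p4:
  fixes A :: "('o, 'm, 'z) category_scheme"
    and F :: "('o, 'm, 'o, 'm) func"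
    and \<mu> \<eta> :: "'o \<Rightarrow> 'm"
  assumes "q_unital_monad A F \<mu> \<eta>"
  shows "(r_unital_monad A F \<mu> \<eta> \<longleftrightarrow>
          regular_pairing A (compatible_module_cat A F \<mu> \<eta>)
            (free_func A F \<mu>) forgetful_func (\<alpha>\<^sub>F A \<eta>) (\<beta>\<^sub>F A F \<mu>)) \<and>
         (weak_monad A F \<mu> \<eta> \<longleftrightarrow>
          regular_pairing A (compatible_module_cat A F \<mu> \<eta>)
            (free_func A F \<mu>) forgetful_func (\<alpha>\<^sub>F A \<eta>) (\<beta>\<^sub>F A F \<mu>) \<and>
          symmetric_\<alpha> A (compatible_module_cat A F \<mu> \<eta>)
            (free_func A F \<mu>) forgetful_func (\<alpha>\<^sub>F A \<eta>) (\<beta>\<^sub>F A F \<mu>))"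
proof -
  interpret q_unital_monad A F \<mu> \<eta> by fact
  show ?thesis
    using regular_pairing_if_r_unital r_unital_if_regular_pairing symmetric_\<alpha>_iff_symmetric_\<eta>
      q_unital_monad_axioms
    unfolding weak_monad_def weak_monad_axioms_def r_unital_monad_def r_unital_monad_axioms_def
    by blast
qed

end
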